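(* Every infinite finitely generated group $B$ admits a quasi-Hamiltonian Cayley graph; that is, there is a finite generating set $S_B$ of $B$ such that $\mathrm{Cay}(B,S_B)$ with base vertex $e_B$ is quasi-Hamiltonian.
   Context: $\mathrm{Cay}(B,S)$ is the undirected, unlabeled graph with vertex set $B$ in which $g,g'$ are joined by an edge iff $g=g's$ for some $s\in S\cup S^{-1}$. A path in a graph is a sequence $v_1,\dots,v_n$ of not necessarily distinct vertices with consecutive ones adjacent; its length is $n$. For a graph $\Gamma$, vertices $u,v$ and a finite set $F$ of vertices, $\mathrm{TS}(u,v,F)$ is the minimal length of a path in $\Gamma$ which starts at $u$, ends at $v$ and visits all vertices of $F$. Let $\Gamma$ be an infinite, connected, locally finite graph with a fixed vertex $o$, and let $B_n$ be the ball of radius $n$ centered at $o$. $(\Gamma,o)$ is quasi-Hamiltonian if there is a family $\mathcal F$ of connected finite induced subgraphs of $\Gamma$ such that (1) $o\in F$ for every $F\in\mathcal F$; (2) for every $n\ge1$ there is $F\in\mathcal F$ with $B_n\subseteq F$; (3) there is a constant $M\ge0$ such that $\mathrm{TS}(o,x,F)\le |F|+M$ for all $F\in\mathcal F$ and all $x\in F$. *)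

theory Defs
  imports
    "HOL-Algebra.Generated_Groups"
    "HOL-Library.Extended_Nat"
    "Graph_Theory.Graph_Theory"
begin

text \<open>
  An undirected graph without multiple edges is a symmetric \<^typ>\<open>'a pair_pre_digraph\<close>
  (locale \<^locale>\<open>pair_sym_digraph\<close>): the edge joining u and v is the pair of arcs (u, v), (v, u).
  Loops are allowed, so that \<open>\<one> \<in> S\<close> is permitted in a Cayley graph; they affect none of the
  notions below.
\<close>

definition cayley_graph :: "('a, 'm) monoid_scheme \<Rightarrow> 'a set \<Rightarrow> 'a pair_pre_digraph" where
  "cayley_graph B S =
    \<lparr> pverts = carrier B,
      parcs = {(g, g'). g \<in> carrier B \<and> g' \<in> carrier B \<and>
                (\<exists>s \<in> S \<union> m_inv B ` S. g = g' \<otimes>\<^bsub>B\<^esub> s)} \<rparr>"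

definition locally_finite :: "'a pair_pre_digraph \<Rightarrow> bool" where
  "locally_finite \<Gamma> \<longleftrightarrow> (\<forall>v \<in> pverts \<Gamma>. finite (out_arcs (with_proj \<Gamma>) v))"

text \<open>The radius refers to the graph distance, where length is the number of edges.\<close>

definition graph_ball :: "'a pair_pre_digraph \<Rightarrow> 'a \<Rightarrow> nat \<Rightarrow> 'a set" where
  "graph_ball \<Gamma> r n =
    {v. \<exists>p. vwalk p (with_proj \<Gamma>) \<and> hd p = r \<and> last p = v \<and> vwalk_length p \<le> n}"

text \<open>
  In contrast to the ball, the length of a path in TS is its number of vertices, counted with
  repetition, i.e. \<^const>\<open>length\<close> and not \<^const>\<open>vwalk_length\<close>. The value is \<open>\<infinity>\<close> if no path from
  u to v in \<open>\<Gamma>\<close> visits all of F.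
\<close>

definition TS :: "'a pair_pre_digraph \<Rightarrow> 'a \<Rightarrow> 'a \<Rightarrow> 'a set \<Rightarrow> enat" where
  "TS \<Gamma> u v F =
    (INF p \<in> {p. vwalk p (with_proj \<Gamma>) \<and> hd p = u \<and> last p = v \<and> F \<subseteq> set p}. enat (length p))"

text \<open>The constant name \<open>connected\<close> is qualified because it also denotes the topological notion.\<close>

definition quasi_hamiltonian :: "'a pair_pre_digraph \<Rightarrow> 'a \<Rightarrow> bool" where
  "quasi_hamiltonian \<Gamma> r \<longleftrightarrow>
    pair_sym_digraph \<Gamma> \<and> infinite (pverts \<Gamma>) \<and> Digraph_Component.connected (with_proj \<Gamma>) \<and>
    locally_finite \<Gamma> \<and> r \<in> pverts \<Gamma> \<and>
    (\<exists>\<F> :: 'a pair_pre_digraph set.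
      (\<forall>F \<in> \<F>. induced_subgraph (with_proj F) (with_proj \<Gamma>) \<and> finite (pverts F) \<and>
        Digraph_Component.connected (with_proj F)) \<and>
      (\<forall>F \<in> \<F>. r \<in> pverts F) \<and>
      (\<forall>n \<ge> 1. \<exists>F \<in> \<F>. graph_ball \<Gamma> r n \<subseteq> pverts F) \<and>
      (\<exists>M :: nat. \<forall>F \<in> \<F>. \<forall>x \<in> pverts F. TS \<Gamma> r x (pverts F) \<le> enat (card (pverts F) + M)))"

definition finite_generating_set :: "('a, 'm) monoid_scheme \<Rightarrow> 'a set \<Rightarrow> bool" where
  "finite_generating_set B S \<longleftrightarrow> finite S \<and> S \<subseteq> carrier B \<and> generate B S = carrier B"

end

theory Submission
  imports Defs
begin

text \<open>
  The cube of a finite connected graph \<open>F\<close> is Hamilton-connected: for \<open>x \<noteq> y\<close> let \<open>C\<close> be the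
  component of \<open>y\<close> in \<open>F - {x}\<close>; then \<open>F - C\<close> is connected too, and by induction a Hamiltonian path of
  \<open>F - C\<close> from \<open>x\<close> to a neighbour of \<open>x\<close> can be joined, across an edge from \<open>x\<close> to some \<open>v \<in> C\<close>, to
  a Hamiltonian path of \<open>C\<close> from \<open>v\<close>, or from a neighbour of \<open>v\<close> if \<open>v = y\<close>, to \<open>y\<close>. Hence, if a finite set \<open>S\<close> generates
  \<open>B\<close> and \<open>S\<^sub>B\<close> is the ball of radius 3 in the Cayley graph of \<open>S\<close>, then every finite set \<open>F\<close> that
  contains the identity and is connected in the Cayley graph of \<open>S\<close> has, in the Cayley graph of
  \<open>S\<^sub>B\<close>, a Hamiltonian path from the identity to each other vertex of \<open>F\<close>. Returning to the
  identity itself costs one more vertex, so \<open>M = 1\<close> works for the family of all these \<open>F\<close>.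
\<close>

section \<open>Hamiltonian paths in the cube of a connected relation\<close>

text \<open>\<open>rtrancl_on F R\<close> keeps the whole walk inside \<open>F\<close>, so for
  symmetric \<open>R\<close> this is connectedness of the induced subgraph; the empty set
  qualifies.\<close>

definition connected_on :: "'a set \<Rightarrow> 'a rel \<Rightarrow> bool" where
  "connected_on F R \<longleftrightarrow> (\<forall>u \<in> F. \<forall>v \<in> F. (u, v) \<in> rtrancl_on F R)"

text \<open>Distance at most 3: the reflexive closures admit shorter walks. Intermediate vertices
  may lie outside the set that a Hamiltonian path visits.\<close>

definition cube :: "'a rel \<Rightarrow> 'a rel" where
  "cube R = R\<^sup>= O R\<^sup>= O R\<^sup>="

lemma sym_cube: "sym R \<Longrightarrow> sym (cube R)"
  unfolding cube_def sym_conv_converse_eq by (simp add: converse_relcomp O_assoc converse_Un)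

lemma finite_cube_Image:
  assumes "\<And>v. finite (R `` {v})" and "finite X"
  shows "finite (cube R `` X)"
proof -
  have "finite (R\<^sup>= `` Y)" if "finite Y" for Y
  proof -
    have "R\<^sup>= `` Y = (\<Union>v\<in>Y. R `` {v}) \<union> Y" by auto
    with that assms(1) show ?thesis by simp
  qed
  with assms(2) show ?thesis by (simp only: cube_def relcomp_Image)
qed

lemma connected_on_via:
  assumes "sym R" and via: "\<And>u. u \<in> F \<Longrightarrow> (u, w) \<in> rtrancl_on F R"
  shows "connected_on F R"
  unfolding connected_on_def
proof (intro ballI)
  fix u v assume "u \<in> F" "v \<in> F"
  then have "(u, w) \<in> rtrancl_on F R" "(w, v) \<in> rtrancl_on F R"
    using via symD[OF rtrancl_on_sym[OF assms(1)]] by blast+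
  then show "(u, v) \<in> rtrancl_on F R" by (rule rtrancl_on_trans)
qed

lemma connected_on_neighbour:
  assumes "connected_on F R" "x \<in> F" "F \<noteq> {x}"
  obtains x' where "x' \<in> F" "x' \<noteq> x" "(x, x') \<in> R"
proof -
  from assms obtain w where w: "w \<in> F" "w \<noteq> x" by blast
  with assms have "(x, w) \<in> rtrancl_on F R" by (auto simp: connected_on_def)
  then have "w = x \<or> (\<exists>x'\<in>F. x' \<noteq> x \<and> (x, x') \<in> R)"
    by (induction rule: rtrancl_on_induct) auto
  with w that show thesis by blast
qed

text \<open>By \<open>C_step\<close>, a walk in \<open>F\<close> can enter or leave \<open>C\<close>
  only through \<open>x\<close>. So a walk from \<open>x\<close> to \<open>y\<close> yields the edge
  from \<open>x\<close> into \<open>C\<close>, and a walk from outside \<open>C\<close> to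
  \<open>x\<close>, cut at its first visit to \<open>x\<close>, avoids \<open>C\<close>.\<close>

lemma connected_on_split:
  assumes R: "sym R" and F: "connected_on F R" and xy: "x \<in> F" "y \<in> F" "x \<noteq> y"
  obtains C v where "C \<subseteq> F" "x \<notin> C" "y \<in> C" "v \<in> C" "(x, v) \<in> R"
    "connected_on C R" "connected_on (F - C) R"
proof -
  define C where "C = {z. (z, y) \<in> rtrancl_on (F - {x}) R}"
  have C_sub: "C \<subseteq> F - {x}" unfolding C_def by (auto dest: in_rtrancl_on_in_F)
  have y: "y \<in> C" using xy by (auto simp: C_def)
  have C_step: "z \<in> C" if "(z, z') \<in> R" "z' \<in> C" "z \<in> F" "z \<noteq> x" for z z'
    using that by (auto simp: C_def intro: converse_rtrancl_on_into_rtrancl_on)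
  \<comment> \<open>The walk to \<open>y\<close> is only known to avoid \<open>x\<close>; each of
    its vertices reaches \<open>y\<close> by the rest of the walk and so lies in
    \<open>C\<close>.\<close>
  have "(u, y) \<in> rtrancl_on C R" if "u \<in> C" for u
  proof -
    from that have "(u, y) \<in> rtrancl_on (F - {x}) R" by (simp add: C_def)
    then show ?thesis
    proof (induction rule: converse_rtrancl_on_induct)
      case base
      show ?case using y by simp
    next
      case (step u u')
      then have "u \<in> C" by (auto simp: C_def intro: converse_rtrancl_on_into_rtrancl_on)
      with step show ?case by (auto intro: converse_rtrancl_on_into_rtrancl_on)
    qed
  qed
  then have C: "connected_on C R" by (rule connected_on_via[OF R])
  have "z \<in> C \<or> (\<exists>v\<in>C. (x, v) \<in> R)" if "(z, y) \<in> rtrancl_on F R" for z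
    using that
  proof (induction rule: converse_rtrancl_on_induct)
    case base
    show ?case using y by simp
  next
    case (step z z')
    then show ?case using C_step by metis
  qed
  with F xy C_sub obtain v where v: "v \<in> C" "(x, v) \<in> R"
    unfolding connected_on_def by blast
  have "(u, x) \<in> rtrancl_on (F - C) R" if u: "u \<in> F - C" for u
  proof -
    from u F xy have "(u, x) \<in> rtrancl_on F R" by (auto simp: connected_on_def)
    \<comment> \<open>Suffixes of the walk may start in \<open>C\<close>, since the walk may pass
      through \<open>x\<close> and enter \<open>C\<close> before it ends at \<open>x\<close>; hence
      the disjunction.\<close>
    then have "u \<in> C \<or> (u, x) \<in> rtrancl_on (F - C) R"
    proof (induction rule: converse_rtrancl_on_induct)
      case base
      show ?case using xy C_sub by auto
    next
      case (step z z')
      show ?case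
      proof (cases "z \<in> C \<or> z = x")
        case True
        then show ?thesis using xy C_sub by auto
      next
        case False
        with step C_step have "(z', x) \<in> rtrancl_on (F - C) R" by blast
        with False step show ?thesis by (auto intro: converse_rtrancl_on_into_rtrancl_on)
      qed
    qed
    with u show ?thesis by blast
  qed
  then have "connected_on (F - C) R" by (rule connected_on_via[OF R])
  with that[of C v] C_sub y v C show thesis by blast
qed

section \<open>Hamiltonian paths with prescribed ends\<close>

definition hamiltonian_path :: "'a rel \<Rightarrow> 'a set \<Rightarrow> 'a \<Rightarrow> 'a \<Rightarrow> 'a list \<Rightarrow> bool" where
  "hamiltonian_path R F x y p \<longleftrightarrow>
    p \<noteq> [] \<and> set p = F \<and> distinct p \<and> hd p = x \<and> last p = y \<and> successively (\<lambda>u v. (u, v) \<in> R) p"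

lemma hamiltonian_path_append:
  assumes "hamiltonian_path R A x x' p" "hamiltonian_path R C y' y q" "(x', y') \<in> R" "A \<inter> C = {}"
  shows "hamiltonian_path R (A \<union> C) x y (p @ q)"
  using assms by (auto simp: hamiltonian_path_def successively_append_iff)

lemma hamiltonian_path_rev:
  assumes "sym R" "hamiltonian_path R F x y p"
  shows "hamiltonian_path R F y x (rev p)"
  using assms
  by (auto simp: hamiltonian_path_def hd_rev last_rev elim!: successively_mono dest: symD)

theorem cube_hamilton_connected:
  assumes "sym R" "finite F" "connected_on F R" "x \<in> F" "y \<in> F" "x \<noteq> y"
  shows "\<exists>p. hamiltonian_path (cube R) F x y p"
  using assms(2-)
proof (induction F arbitrary: x y rule: finite_psubset_induct)
  case (psubset F)
  \<comment> \<open>The reflexive closure covers the singleton \<open>A\<close>, where the path ends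
    at \<open>x\<close> itself; otherwise the induction hypothesis leads to a neighbour of
    \<open>x\<close>.\<close>
  have to_nbr: "\<exists>x' p. (x, x') \<in> R\<^sup>= \<and> hamiltonian_path (cube R) A x x' p"
    if A: "A \<subset> F" "connected_on A R" "x \<in> A" for A x
  proof (cases "A = {x}")
    case True
    then have "hamiltonian_path (cube R) A x x [x]" by (simp add: hamiltonian_path_def)
    then show ?thesis by blast
  next
    case False
    with A connected_on_neighbour[of A R x] obtain x' where "x' \<in> A" "x' \<noteq> x" "(x, x') \<in> R"
      by metis
    with psubset.IH[of A x x'] A show ?thesis by auto
  qed
  obtain C v where C: "C \<subseteq> F" "x \<notin> C" "y \<in> C" "v \<in> C" "(x, v) \<in> R"
    "connected_on C R" "connected_on (F - C) R"
    using connected_on_split[OF assms(1) psubset.prems] by metis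
  from C psubset.prems have "F - C \<subset> F" "x \<in> F - C" by auto
  with to_nbr C obtain x' p where p: "(x, x') \<in> R\<^sup>=" "hamiltonian_path (cube R) (F - C) x x' p"
    by metis
  \<comment> \<open>The induction hypothesis needs distinct ends. If \<open>v = y\<close>, a path
    from \<open>y\<close> given by \<open>to_nbr\<close> is reversed, so that it starts at a
    neighbour of \<open>y\<close>, or at \<open>y\<close> itself if \<open>C\<close> is a
    singleton.\<close>
  have "\<exists>y' q. (v, y') \<in> R\<^sup>= \<and> hamiltonian_path (cube R) C y' y q"
  proof (cases "v = y")
    case True
    from C psubset.prems have "C \<subset> F" by auto
    with to_nbr C obtain y' q where "(y, y') \<in> R\<^sup>=" "hamiltonian_path (cube R) C y y' q"
      by metis
    with True hamiltonian_path_rev[OF sym_cube[OF assms(1)]] show ?thesis by blast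
  next
    case False
    from C psubset.prems have "C \<subset> F" by auto
    with psubset.IH[of C v y] C False show ?thesis by auto
  qed
  then obtain y' q where q: "(v, y') \<in> R\<^sup>=" "hamiltonian_path (cube R) C y' y q" by blast
  \<comment> \<open>The junction runs along \<open>x'\<close>, \<open>x\<close>, \<open>v\<close>,
    \<open>y'\<close>: three steps, each an edge or trivial, whence the cube.\<close>
  have "(x', x) \<in> R\<^sup>=" using p(1) assms(1) by (auto dest: symD)
  with q(1) C(5) have "(x', y') \<in> cube R" unfolding cube_def by blast
  from hamiltonian_path_append[OF p(2) q(2) this] C(1) show ?case
    by (metis Diff_disjoint Diff_partition Int_commute Un_commute)
qed

section \<open>Finite connected sets around a given finite set\<close>

text \<open>Supplies the sets that contain the balls: \<open>F\<close> is a union of finitely many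
  walks that share the start \<open>r\<close>. The bound by \<open>Range R\<close> later keeps
  \<open>F\<close> among the vertices.\<close>

lemma finite_connected_hull:
  assumes R: "sym R" and X: "finite X" and reach: "\<And>x. x \<in> X \<Longrightarrow> (r, x) \<in> R\<^sup>*"
  obtains F where "finite F" "r \<in> F" "X \<subseteq> F" "connected_on F R" "F \<subseteq> insert r (Range R)"
proof -
  \<comment> \<open>Reachability is claimed for all of \<open>F\<close>, not only for
    \<open>x\<close>, so that unions of such sets remain connected through \<open>r\<close>.\<close>
  have path: "\<exists>F. finite F \<and> F \<subseteq> insert r (Range R) \<and> (r, x) \<in> rtrancl_on F R
      \<and> (\<forall>u\<in>F. (r, u) \<in> rtrancl_on F R)"
    if "(r, x) \<in> R\<^sup>*" for x
    using that
  proof induction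
    case base
    show ?case by (rule exI[of _ "{r}"]) auto
  next
    case (step x y)
    then obtain F where F: "finite F" "F \<subseteq> insert r (Range R)" "(r, x) \<in> rtrancl_on F R"
      "\<forall>u\<in>F. (r, u) \<in> rtrancl_on F R" by blast
    have mono: "(r, u) \<in> rtrancl_on (insert y F) R" if "(r, u) \<in> rtrancl_on F R" for u
      using rtrancl_on_mono[OF _ _ that] by blast
    have "(r, y) \<in> rtrancl_on (insert y F) R"
      using mono[OF F(3)] step by (auto intro: rtrancl_on_into_rtrancl_on)
    with F mono step show ?case by (intro exI[of _ "insert y F"]) auto
  qed
  have "\<exists>F. finite F \<and> F \<subseteq> insert r (Range R) \<and> r \<in> F \<and> X \<subseteq> F
      \<and> (\<forall>u\<in>F. (r, u) \<in> rtrancl_on F R)"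
    using X reach
  proof induction
    case empty
    show ?case by (rule exI[of _ "{r}"]) auto
  next
    case (insert x X)
    then obtain F where F: "finite F" "F \<subseteq> insert r (Range R)" "r \<in> F" "X \<subseteq> F"
      "\<forall>u\<in>F. (r, u) \<in> rtrancl_on F R" by auto
    obtain G where G: "finite G" "G \<subseteq> insert r (Range R)" "(r, x) \<in> rtrancl_on G R"
      "\<forall>u\<in>G. (r, u) \<in> rtrancl_on G R" using path[of x] insert.prems[of x] by auto
    have "(r, u) \<in> rtrancl_on (F \<union> G) R" if "u \<in> F \<union> G" for u
      using that F(5) G(4) rtrancl_on_mono[of R R F "F \<union> G"] rtrancl_on_mono[of R R G "F \<union> G"]
      by blast
    moreover have "x \<in> G" using G(3) by (rule in_rtrancl_on_in_F)
    ultimately show ?case using F G by (intro exI[of _ "F \<union> G"]) auto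
  qed
  then obtain F where F: "finite F" "F \<subseteq> insert r (Range R)" "r \<in> F" "X \<subseteq> F"
    "\<And>u. u \<in> F \<Longrightarrow> (r, u) \<in> rtrancl_on F R" by blast
  have "connected_on F R"
    using F(5) symD[OF rtrancl_on_sym[OF R]] by (intro connected_on_via[OF R]) blast
  with F that show thesis by blast
qed

section \<open>Pair digraphs\<close>

text \<open>Connectedness of a digraph is strong connectedness of its symmetric closure, which only
  adds arcs to those of \<open>G\<close>.\<close>

lemma connected_with_projI:
  assumes "pverts G \<noteq> {}" "connected_on (pverts G) (parcs G)"
  shows "Digraph_Component.connected (with_proj G)"
proof -
  have "parcs G \<subseteq> parcs (mk_symmetric (with_proj G))"
    by (force simp: parcs_mk_symmetric)
  with assms show ?thesis
    unfolding Digraph_Component.connected_def strongly_connected_def reachable_def connected_on_def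
    by (auto intro: rtrancl_on_mono)
qed

text \<open>A walk with at most \<open>n + 1\<close> edges is trivial or continues from one of
  finitely many out-neighbours of \<open>r\<close> with at most \<open>n\<close> edges; hence the
  induction for all centres.\<close>

lemma finite_graph_ball:
  assumes "locally_finite G" "r \<in> pverts G"
  shows "finite (graph_ball G r n)"
  using assms(2)
proof (induction n arbitrary: r)
  case 0
  have "graph_ball G r 0 \<subseteq> {r}"
    by (auto simp: graph_ball_def vwalk_def neq_Nil_conv le_Suc_eq)
  then show ?case by (rule finite_subset) simp
next
  case (Suc n)
  let ?N = "{s \<in> pverts G. (r, s) \<in> parcs G}"
  have "snd ` out_arcs (with_proj G) r \<supseteq> ?N" by (force simp: out_arcs_def)
  with assms(1) Suc.prems have "finite ?N"
    by (auto simp: locally_finite_def intro: finite_subset)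
  moreover have "graph_ball G r (Suc n) \<subseteq> insert r (\<Union>s\<in>?N. graph_ball G s n)"
  proof
    fix v assume "v \<in> graph_ball G r (Suc n)"
    then obtain p where p: "vwalk p (with_proj G)" "hd p = r" "last p = v" "length p - 1 \<le> Suc n"
      by (auto simp: graph_ball_def)
    show "v \<in> insert r (\<Union>s\<in>?N. graph_ball G s n)"
    proof (cases "length p \<le> 1")
      case True
      with p show ?thesis by (cases p) auto
    next
      case False
      then obtain s q where q: "p = r # s # q" using p(2) by (cases p; cases "tl p") auto
      with p have "vwalk (s # q) (with_proj G)" "(r, s) \<in> parcs G" "s \<in> pverts G"
        by (auto simp: vwalk_def)
      moreover from this q p have "v \<in> graph_ball G s n"
        by (auto simp: graph_ball_def intro!: exI[of _ "s # q"])
      ultimately show ?thesis by blast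
    qed
  qed
  ultimately show ?case using Suc.IH by (auto intro: finite_subset)
qed

section \<open>Bounds on \<open>TS\<close>\<close>

lemma TS_le:
  assumes "vwalk p (with_proj G)" "hd p = u" "last p = v" "F \<subseteq> set p"
  shows "TS G u v F \<le> enat (length p)"
  unfolding TS_def using assms by (intro INF_lower) auto

lemma vwalk_if_successively:
  assumes "p \<noteq> []" "set p \<subseteq> pverts G" "successively (\<lambda>u v. (u, v) \<in> parcs G) p"
  shows "vwalk p (with_proj G)"
proof -
  have "set (vwalk_arcs p) \<subseteq> parcs G"
    using assms(3) by (induction p rule: vwalk_arcs.induct) auto
  with assms show ?thesis by (auto simp: vwalk_def)
qed

text \<open>A Hamiltonian path of \<open>F\<close> has exactly \<open>card F\<close> vertices, which
  settles \<open>x \<noteq> r\<close>; the extra 1 pays for a tour that returns to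
  \<open>r\<close>.\<close>

lemma TS_cube_le:
  assumes R: "sym R" and F: "finite F" "connected_on F R" and mem: "r \<in> F" "x \<in> F"
    and G: "F \<subseteq> pverts G" "cube R \<inter> F \<times> F \<subseteq> parcs G"
  shows "TS G r x F \<le> enat (card F + 1)"
proof -
  have walk: "vwalk p (with_proj G) \<and> length p = card F" if "hamiltonian_path (cube R) F u v p" for u v p
  proof -
    have "successively (\<lambda>u v. (u, v) \<in> parcs G) p"
      using that G(2) by (auto simp: hamiltonian_path_def elim!: successively_mono)
    with that G(1) show ?thesis
      by (auto simp: hamiltonian_path_def distinct_card intro!: vwalk_if_successively)
  qed
  show ?thesis
  proof (cases "x = r")
    case False
    then obtain p where p: "hamiltonian_path (cube R) F r x p"
      using cube_hamilton_connected[OF R F mem] by auto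
    with walk[OF p] have "TS G r x F \<le> enat (card F)"
      using TS_le[of p G r x F] by (auto simp: hamiltonian_path_def)
    also have "\<dots> \<le> enat (card F + 1)" by simp
    finally show ?thesis .
  next
    case True
    show ?thesis
    proof (cases "F = {r}")
      case True
      with \<open>x = r\<close> G TS_le[of "[r]" G r r F] have "TS G r x F \<le> enat 1"
        by (auto simp: vwalk_def one_enat_def)
      also have "\<dots> \<le> enat (card F + 1)" by simp
      finally show ?thesis .
    next
      case False
      \<comment> \<open>A Hamiltonian path from a neighbour \<open>s\<close> to \<open>r\<close>,
        preceded by \<open>r\<close>, is a closed tour with \<open>card F + 1\<close>
        vertices.\<close>
      with connected_on_neighbour[OF F(2) mem(1)] obtain s where s: "s \<in> F" "s \<noteq> r" "(r, s) \<in> R"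
        by metis
      then obtain p where p: "hamiltonian_path (cube R) F s r p"
        using cube_hamilton_connected[OF R F s(1) mem(1)] by auto
      from s have "(r, s) \<in> cube R" by (auto simp: cube_def)
      with s mem G have "(r, s) \<in> parcs G" by auto
      with walk[OF p] p G mem have "vwalk (r # p) (with_proj G)"
        by (intro vwalk_consI) (auto simp: hamiltonian_path_def)
      with walk[OF p] p \<open>x = r\<close> show ?thesis
        using TS_le[of "r # p" G r x F] by (auto simp: hamiltonian_path_def)
    qed
  qed
qed

text \<open>Two adjacency relations are kept apart: the members of the family are connected with
  respect to \<open>R\<close>, while the tours run in \<open>G\<close>, whose arcs contain the cube
  of \<open>R\<close> on the vertices.\<close>

lemma quasi_hamiltonian_if_cube:
  fixes G :: "'a pair_pre_digraph"
  assumes G: "pair_sym_digraph G" "infinite (pverts G)" "locally_finite G" "r \<in> pverts G"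
    and R: "sym R" "R \<subseteq> pverts G \<times> pverts G" "\<And>v. v \<in> pverts G \<Longrightarrow> (r, v) \<in> R\<^sup>*"
    and cube: "cube R \<inter> pverts G \<times> pverts G \<subseteq> parcs G"
  shows "quasi_hamiltonian G r"
proof -
  interpret pair_sym_digraph G by fact
  define sub where
    "sub X = \<lparr> pverts = X, parcs = parcs G \<inter> X \<times> X \<rparr>" for X :: "'a set"
  define \<F> where "\<F> = sub ` {X. finite X \<and> r \<in> X \<and> X \<subseteq> pverts G \<and> connected_on X R}"
  have R_arcs: "R \<subseteq> parcs G" using R(2) cube by (auto simp: cube_def)
  have sub_induced: "induced_subgraph (with_proj (sub X)) (with_proj G)" if "X \<subseteq> pverts G" for X
  proof -
    have "with_proj (sub X) = with_proj G \<restriction> X"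
      by (auto simp: with_proj_def sub_def induce_subgraph_def)
    with that show ?thesis using induced_induce[of X] by simp
  qed
  have sub_conn: "Digraph_Component.connected (with_proj (sub X))"
    if "r \<in> X" "X \<subseteq> pverts G" "connected_on X R" for X
  proof (rule connected_with_projI)
    have "(u, v) \<in> rtrancl_on X (parcs G \<inter> X \<times> X)" if "(u, v) \<in> rtrancl_on X R" for u v
      using that R_arcs by (induction rule: rtrancl_on_induct) (auto intro: rtrancl_on_into_rtrancl_on)
    with that show "connected_on (pverts (sub X)) (parcs (sub X))"
      by (auto simp: sub_def connected_on_def)
  qed (use that in \<open>auto simp: sub_def\<close>)
  have "connected_on (pverts G) R"
  proof (rule connected_on_via[OF R(1)])
    fix u assume u: "u \<in> pverts G"
    have "(r, u) \<in> rtrancl_on (pverts G) R"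
      using R(3)[OF u] G(4) u by (rule rtrancl_consistent_rtrancl_on) (use R(2) in auto)
    then show "(u, r) \<in> rtrancl_on (pverts G) R" by (rule symD[OF rtrancl_on_sym[OF R(1)]])
  qed
  then have "connected_on (pverts G) (parcs G)"
    using rtrancl_on_mono[OF R_arcs subset_refl] unfolding connected_on_def by blast
  then have conn: "Digraph_Component.connected (with_proj G)"
    using G(4) by (intro connected_with_projI) auto
  have balls: "\<exists>F\<in>\<F>. graph_ball G r n \<subseteq> pverts F" for n
  proof -
    have "graph_ball G r n \<subseteq> pverts G" by (auto simp: graph_ball_def vwalk_def)
    \<comment> \<open>The ball is one of \<open>G\<close> and not known to be
      \<open>R\<close>-connected, so it is enlarged to a finite \<open>R\<close>-connected
      set.\<close>
    then obtain F where F: "finite F" "r \<in> F" "graph_ball G r n \<subseteq> F" "connected_on F R"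
      "F \<subseteq> insert r (Range R)"
      using finite_connected_hull[OF R(1) finite_graph_ball[OF G(3,4)], of n r] R(3)
      by (metis subsetD)
    moreover from this R(2) G(4) have "F \<subseteq> pverts G" by auto
    ultimately show ?thesis by (auto simp: \<F>_def sub_def)
  qed
  have tours: "TS G r x (pverts F) \<le> enat (card (pverts F) + 1)" if "F \<in> \<F>" "x \<in> pverts F" for F x
  proof -
    from that obtain X where "pverts F = X" "finite X" "r \<in> X" "X \<subseteq> pverts G" "connected_on X R"
      by (auto simp: \<F>_def sub_def)
    with that cube show ?thesis by (auto intro!: TS_cube_le[OF R(1), simplified])
  qed
  have sub: "induced_subgraph (with_proj F) (with_proj G) \<and> finite (pverts F) \<and>
      Digraph_Component.connected (with_proj F) \<and> r \<in> pverts F" if "F \<in> \<F>" for F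
  proof -
    from that obtain X where "F = sub X" "finite X" "r \<in> X" "X \<subseteq> pverts G" "connected_on X R"
      by (auto simp: \<F>_def)
    with sub_induced sub_conn show ?thesis by (auto simp: sub_def)
  qed
  show ?thesis
    unfolding quasi_hamiltonian_def
    by (intro conjI exI[of _ \<F>] exI[of _ 1] ballI allI impI) (use G conn balls tours sub in auto)
qed

section \<open>Cayley graphs\<close>

context group
begin

lemma pverts_cayley_graph [simp]: "pverts (cayley_graph G S) = carrier G"
  by (simp add: cayley_graph_def)

lemma parcs_cayley_graph_subset: "parcs (cayley_graph G S) \<subseteq> carrier G \<times> carrier G"
  by (auto simp: cayley_graph_def)

text \<open>The quotient \<open>inv h \<otimes> g\<close> is what makes symmetry and left invariance
  visible: inversion swaps \<open>g\<close> and \<open>h\<close>, and a common left factor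
  cancels.\<close>

lemma parcs_cayley_graph_iff:
  assumes "S \<subseteq> carrier G" "g \<in> carrier G" "h \<in> carrier G"
  shows "(g, h) \<in> parcs (cayley_graph G S) \<longleftrightarrow> inv h \<otimes> g \<in> S \<union> m_inv G ` S"
proof -
  have "S \<union> m_inv G ` S \<subseteq> carrier G" using assms(1) by auto
  then have "g = h \<otimes> s \<longleftrightarrow> inv h \<otimes> g = s" if "s \<in> S \<union> m_inv G ` S" for s
    using that assms(2,3) inv_solve_left by (metis subsetD)
  with assms(2,3) show ?thesis unfolding cayley_graph_def by auto
qed

lemma sym_parcs_cayley_graph:
  assumes "S \<subseteq> carrier G"
  shows "sym (parcs (cayley_graph G S))"
proof (rule symI)
  fix g h assume gh: "(g, h) \<in> parcs (cayley_graph G S)"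
  then have car: "g \<in> carrier G" "h \<in> carrier G" using parcs_cayley_graph_subset by auto
  with assms gh have "inv h \<otimes> g \<in> S \<union> m_inv G ` S" by (simp add: parcs_cayley_graph_iff)
  then have "inv (inv h \<otimes> g) \<in> S \<union> m_inv G ` S"
    using assms by (auto simp: image_iff)
  with assms car show "(h, g) \<in> parcs (cayley_graph G S)"
    by (simp add: parcs_cayley_graph_iff inv_mult_group)
qed

lemma pair_sym_digraph_cayley_graph:
  assumes "S \<subseteq> carrier G"
  shows "pair_sym_digraph (cayley_graph G S)"
proof -
  have "symmetric (with_proj (cayley_graph G S))"
    using sym_parcs_cayley_graph[OF assms] by (simp add: symmetric_def)
  then show ?thesis
    by unfold_locales (use parcs_cayley_graph_subset[of S] in auto)
qed

lemma parcs_cayley_graph_translate: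
  assumes "S \<subseteq> carrier G" "(g, h) \<in> parcs (cayley_graph G S)" "k \<in> carrier G"
  shows "(k \<otimes> g, k \<otimes> h) \<in> parcs (cayley_graph G S)"
proof -
  have "g \<in> carrier G" "h \<in> carrier G" using assms(2) parcs_cayley_graph_subset by auto
  moreover from this assms(3) have "inv (k \<otimes> h) \<otimes> (k \<otimes> g) = inv h \<otimes> g"
    by (simp add: inv_mult_group m_assoc) (simp flip: m_assoc)
  ultimately show ?thesis using assms by (simp add: parcs_cayley_graph_iff)
qed

lemma cube_cayley_graph_translate:
  assumes "S \<subseteq> carrier G" "(g, h) \<in> cube (parcs (cayley_graph G S))" "k \<in> carrier G"
  shows "(k \<otimes> g, k \<otimes> h) \<in> cube (parcs (cayley_graph G S))"
proof -
  have "(k \<otimes> a, k \<otimes> b) \<in> (parcs (cayley_graph G S))\<^sup>=" if "(a, b) \<in> (parcs (cayley_graph G S))\<^sup>=" for a b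
    using that parcs_cayley_graph_translate[OF assms(1) _ assms(3)] by auto
  with assms(2) show ?thesis unfolding cube_def by (elim relcompE) (blast intro: relcompI)
qed

lemma finite_parcs_cayley_graph_Image:
  assumes "finite S" "S \<subseteq> carrier G"
  shows "finite (parcs (cayley_graph G S) `` {v})"
proof -
  have "parcs (cayley_graph G S) `` {v} \<subseteq> (\<lambda>s. v \<otimes> s) ` (S \<union> m_inv G ` S)"
  proof
    fix h assume "h \<in> parcs (cayley_graph G S) `` {v}"
    \<comment> \<open>The definition writes the first vertex of an arc as a multiple of the second,
      so the arc is reversed to exhibit the out-neighbour \<open>h\<close> as some
      \<open>v \<otimes> s\<close>.\<close>
    then have h: "(h, v) \<in> parcs (cayley_graph G S)"
      using sym_parcs_cayley_graph[OF assms(2)] by (auto dest: symD)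
    then show "h \<in> (\<lambda>s. v \<otimes> s) ` (S \<union> m_inv G ` S)" by (auto simp: cayley_graph_def)
  qed
  then show ?thesis using assms(1) by (auto intro: finite_subset)
qed

lemma locally_finite_cayley_graph:
  assumes "finite S" "S \<subseteq> carrier G"
  shows "locally_finite (cayley_graph G S)"
  unfolding locally_finite_def
proof
  fix v
  have "out_arcs (with_proj (cayley_graph G S)) v = Pair v ` (parcs (cayley_graph G S) `` {v})"
    by (auto simp: out_arcs_def)
  then show "finite (out_arcs (with_proj (cayley_graph G S)) v)"
    using finite_parcs_cayley_graph_Image[OF assms] by simp
qed

lemma one_arc_cayley_graph:
  assumes "S \<subseteq> carrier G" "s \<in> S"
  shows "(\<one>, s) \<in> parcs (cayley_graph G S)" "(\<one>, inv s) \<in> parcs (cayley_graph G S)"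
  using assms by (auto simp: parcs_cayley_graph_iff subset_iff)

text \<open>Induction over \<open>generate\<close> for all starting points \<open>g\<close>: for a
  product \<open>h1 \<otimes> h2\<close>, the walk for \<open>h2\<close> starts at
  \<open>g \<otimes> h1\<close>.\<close>

lemma cayley_graph_reaches_generated:
  assumes S: "S \<subseteq> carrier G" and "h \<in> generate G S" and "g \<in> carrier G"
  shows "(g, g \<otimes> h) \<in> (parcs (cayley_graph G S))\<^sup>*"
  using assms(2,3)
proof (induction arbitrary: g)
  case one
  then show ?case by simp
next
  case (incl s)
  then show ?case
    using parcs_cayley_graph_translate[OF S one_arc_cayley_graph(1)[OF S]] by fastforce
next
  case (inv s)
  then show ?case
    using parcs_cayley_graph_translate[OF S one_arc_cayley_graph(2)[OF S]] by fastforce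
next
  case (eng h1 h2)
  from eng.hyps have car: "h1 \<in> carrier G" "h2 \<in> carrier G"
    using generate_in_carrier[OF S] by auto
  then have "(g, g \<otimes> h1) \<in> (parcs (cayley_graph G S))\<^sup>*"
    "(g \<otimes> h1, g \<otimes> h1 \<otimes> h2) \<in> (parcs (cayley_graph G S))\<^sup>*"
    using eng.IH eng.prems by auto
  with car eng.prems show ?case by (simp add: m_assoc)
qed

text \<open>\<open>T\<close> is the ball of radius 3 around the identity. Left translation moves a
  pair at distance at most 3 to one that starts at the identity, so the quotient of the pair belongs
  to \<open>T\<close>.\<close>

lemma cube_cayley_graph:
  assumes S: "S \<subseteq> carrier G"
  defines "T \<equiv> cube (parcs (cayley_graph G S)) `` {\<one>}"
  shows "cube (parcs (cayley_graph G S)) \<inter> carrier G \<times> carrier G \<subseteq> parcs (cayley_graph G T)"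
    and "S \<subseteq> T" and "T \<subseteq> carrier G"
proof -
  show T: "T \<subseteq> carrier G"
    using parcs_cayley_graph_subset by (fastforce simp: T_def cube_def)
  show "S \<subseteq> T"
    using one_arc_cayley_graph(1)[OF S] by (auto simp: T_def cube_def)
  show "cube (parcs (cayley_graph G S)) \<inter> carrier G \<times> carrier G \<subseteq> parcs (cayley_graph G T)"
  proof (clarify)
    fix g h assume gh: "(g, h) \<in> cube (parcs (cayley_graph G S))" "g \<in> carrier G" "h \<in> carrier G"
    \<comment> \<open>The pair is reversed first, so that translation by \<open>inv h\<close> puts
      the identity first and \<open>inv h \<otimes> g\<close>, which decides whether
      \<open>(g, h)\<close> is an arc, second.\<close>
    then have "(h, g) \<in> cube (parcs (cayley_graph G S))"
      using sym_cube[OF sym_parcs_cayley_graph[OF S]] by (auto dest: symD)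
    then have "(inv h \<otimes> h, inv h \<otimes> g) \<in> cube (parcs (cayley_graph G S))"
      using S gh by (intro cube_cayley_graph_translate) auto
    with gh T show "(g, h) \<in> parcs (cayley_graph G T)"
      by (simp add: parcs_cayley_graph_iff T_def)
  qed
qed

end

section \<open>The ball of radius 3 as generating set\<close>

theorem lemma4p7:
  fixes B :: "('a, 'm) monoid_scheme"
  assumes "group B"
    and "infinite (carrier B)"
    and "\<exists>S. finite_generating_set B S"
  shows "\<exists>S\<^sub>B. finite_generating_set B S\<^sub>B \<and> quasi_hamiltonian (cayley_graph B S\<^sub>B) \<one>\<^bsub>B\<^esub>"
proof -
  interpret group B by fact
  from assms(3) obtain S where S: "finite S" "S \<subseteq> carrier B" "generate B S = carrier B"
    by (auto simp: finite_generating_set_def)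
  define R where "R = parcs (cayley_graph B S)"
  define T where "T = cube R `` {\<one>\<^bsub>B\<^esub>}"
  note T = cube_cayley_graph[OF S(2), folded R_def, folded T_def]
  have "finite T"
    unfolding T_def R_def using S by (intro finite_cube_Image finite_parcs_cayley_graph_Image) auto
  moreover have "generate B T = carrier B"
    using mono_generate[OF T(2)] S(3) generate_incl[OF T(3)] by blast
  moreover have "quasi_hamiltonian (cayley_graph B T) \<one>\<^bsub>B\<^esub>"
  proof (rule quasi_hamiltonian_if_cube[where R = R])
    show "(\<one>\<^bsub>B\<^esub>, v) \<in> R\<^sup>*" if "v \<in> pverts (cayley_graph B T)" for v
      using cayley_graph_reaches_generated[OF S(2), of v "\<one>\<^bsub>B\<^esub>"] that S(3) by (simp add: R_def)
  qed (use assms(2) S T \<open>finite T\<close> in \<open>simp_all add: pair_sym_digraph_cayley_graph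
      locally_finite_cayley_graph sym_parcs_cayley_graph parcs_cayley_graph_subset R_def\<close>)
  ultimately show ?thesis using T(3) by (auto simp: finite_generating_set_def)
qed

end
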